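(* Let $k\geqslant 1$ and let $n,r$ be integers with $2\leqslant r\leqslant n-1$. Then $$|\mathcal{E}_{n,k}^{r-1}[n\prec 1]|=(kn-2n+r)\,|\mathcal{E}_{n,k}^{r}[n\prec 1]|.$$
   Context: A $k$-edge colored tree is a (labeled, non-plane) tree whose edges are colored from a set of $k$ colors $\{\mathbf{1},\mathbf{2},\ldots,\mathbf{k}\}$ such that any two edges with a common vertex have different colors. A special $k$-edge colored tree is a rooted $k$-edge colored tree such that all edges joining the root to its children are colored with the first $k-1$ colors $\{\mathbf{1},\ldots,\mathbf{k-1}\}$. $\mathcal{E}_{n,k}^{r}$ denotes the set of forests with vertex set $[n]=\{1,\ldots,n\}$ consisting of exactly $r$ special $k$-edge colored trees whose roots are $1,\ldots,r$ respectively. A vertex $y$ of a forest is a descendant of $x$, written $y\prec x$, if $x$ lies on the path from the root of the tree containing $y$ to $y$. $\mathcal{E}_{n,k}^{r}[n\prec 1]$ denotes the subset of those forests in $\mathcal{E}_{n,k}^{r}$ in which $n\prec 1$, i.e. vertex $n$ lies in the tree rooted at $1$. *)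

theory Defs
  imports "HOL-Library.FuncSet" "HOL-Library.Disjoint_Sets"
begin

text \<open>
  Undirected simple graphs are given by a vertex set and a set of two-element edges.
  (The AFP entry \<open>Graph_Theory\<close> is about digraphs, and its notion of tree only excludes
  directed cycles, so it does not describe undirected trees.)
\<close>

definition simple_graph :: "'a set \<Rightarrow> 'a set set \<Rightarrow> bool" where
  "simple_graph V E \<longleftrightarrow> finite V \<and> (\<forall>e\<in>E. e \<subseteq> V \<and> card e = 2)"

definition path_between :: "'a set set \<Rightarrow> 'a \<Rightarrow> 'a list \<Rightarrow> 'a \<Rightarrow> bool" where
  "path_between E u p v \<longleftrightarrow> p \<noteq> [] \<and> hd p = u \<and> last p = v \<and> distinct p
     \<and> successively (\<lambda>x y. {x, y} \<in> E) p"

definition cycle_in :: "'a set set \<Rightarrow> 'a list \<Rightarrow> bool" where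
  "cycle_in E p \<longleftrightarrow> length p \<ge> 3 \<and> distinct p \<and> successively (\<lambda>x y. {x, y} \<in> E) p
     \<and> {last p, hd p} \<in> E"

definition connected_graph :: "'a set \<Rightarrow> 'a set set \<Rightarrow> bool" where
  "connected_graph V E \<longleftrightarrow> V \<noteq> {} \<and> (\<forall>u\<in>V. \<forall>v\<in>V. \<exists>p. path_between E u p v)"

definition tree :: "'a set \<Rightarrow> 'a set set \<Rightarrow> bool" where
  "tree V E \<longleftrightarrow> simple_graph V E \<and> connected_graph V E \<and> \<not> (\<exists>p. cycle_in E p)"

definition edge_colored_tree :: "nat \<Rightarrow> 'a set \<Rightarrow> 'a set set \<Rightarrow> ('a set \<Rightarrow> nat) \<Rightarrow> bool" where
  "edge_colored_tree k V E c \<longleftrightarrow> tree V E \<and> (\<forall>e\<in>E. c e \<in> {1..k})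
     \<and> (\<forall>e\<in>E. \<forall>f\<in>E. e \<noteq> f \<and> e \<inter> f \<noteq> {} \<longrightarrow> c e \<noteq> c f)"

text \<open>The edges joining the root to its children are exactly the edges containing the root.\<close>

definition special_edge_colored_tree ::
    "nat \<Rightarrow> 'a set \<Rightarrow> 'a set set \<Rightarrow> ('a set \<Rightarrow> nat) \<Rightarrow> 'a \<Rightarrow> bool" where
  "special_edge_colored_tree k V E c \<rho> \<longleftrightarrow> edge_colored_tree k V E c \<and> \<rho> \<in> V
     \<and> (\<forall>e\<in>E. \<rho> \<in> e \<longrightarrow> c e \<in> {1..k - 1})"

text \<open>
  A forest is a pair of an edge set and a colouring; the colouring is extensional, so that it
  carries no information outside the edge set and distinct pairs are distinct forests.
  \<open>W i\<close> is the vertex set of the tree rooted at \<open>i\<close>.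
\<close>

definition special_forests :: "nat \<Rightarrow> nat \<Rightarrow> nat \<Rightarrow> (nat set set \<times> (nat set \<Rightarrow> nat)) set" where
  "special_forests n k r = {(E, c). c \<in> extensional E \<and>
     (\<exists>W. disjoint_family_on W {1..r} \<and> (\<Union>i\<in>{1..r}. W i) = {1..n}
        \<and> (\<forall>e\<in>E. \<exists>i\<in>{1..r}. e \<subseteq> W i)
        \<and> (\<forall>i\<in>{1..r}. special_edge_colored_tree k (W i) {e \<in> E. e \<subseteq> W i} c i))}"

text \<open>\<open>descendant E R y x\<close> is \<open>y \<prec> x\<close> in the forest with edges \<open>E\<close> and set of roots \<open>R\<close>;
  every vertex is a descendant of itself.\<close>

definition descendant :: "'a set set \<Rightarrow> 'a set \<Rightarrow> 'a \<Rightarrow> 'a \<Rightarrow> bool" where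
  "descendant E R y x \<longleftrightarrow> (\<exists>\<rho>\<in>R. \<exists>p. path_between E \<rho> p y \<and> x \<in> set p)"

definition special_forests_desc ::
    "nat \<Rightarrow> nat \<Rightarrow> nat \<Rightarrow> nat \<Rightarrow> nat \<Rightarrow> (nat set set \<times> (nat set \<Rightarrow> nat)) set" where
  "special_forests_desc n k r y x =
     {(E, c) \<in> special_forests n k r. descendant E {1..r} y x}"

text \<open>The cardinalities in question are those of finite sets.\<close>

lemma finite_special_forests: "finite (special_forests n k r)"
proof -
  let ?P = "Pow {1..n}"
  have "special_forests n k r \<subseteq> Sigma (Pow ?P) (\<lambda>E. E \<rightarrow>\<^sub>E {1..k})"
  proof clarify
    fix E c assume "(E, c) \<in> special_forests n k r"
    then obtain W where ext: "c \<in> extensional E" and U: "(\<Union>i\<in>{1..r}. W i) = {1..n}"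
      and E: "\<forall>e\<in>E. \<exists>i\<in>{1..r}. e \<subseteq> W i"
      and T: "\<forall>i\<in>{1..r}. special_edge_colored_tree k (W i) {e \<in> E. e \<subseteq> W i} c i"
      unfolding special_forests_def by blast
    have "E \<subseteq> ?P" using E U by blast
    moreover have "\<forall>e\<in>E. c e \<in> {1..k}"
      using E T unfolding special_edge_colored_tree_def edge_colored_tree_def by blast
    ultimately show "E \<in> Pow ?P \<and> c \<in> E \<rightarrow>\<^sub>E {1..k}" using ext by (auto simp: PiE_def)
  qed
  moreover have "finite (Sigma (Pow ?P) (\<lambda>E. E \<rightarrow>\<^sub>E {1..k}))"
    by (intro finite_SigmaI finite_PiE) (auto intro: finite_subset)
  ultimately show ?thesis by (rule finite_subset)
qed

lemma finite_special_forests_desc: "finite (special_forests_desc n k r y x)"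
  by (rule finite_subset[OF _ finite_special_forests]) (auto simp: special_forests_desc_def)

end

theory Submission
  imports Defs "HOL-Combinatorics.Transposition"
begin

text \<open>
  Orient every edge towards its root and transpose, at each vertex, the colour \<open>k\<close> with the colour
  of the edge to its parent: a special forest becomes an injective map sending each non-root to
  a pair of its parent and one of \<open>k - 1\<close> slots at the parent. With \<open>r\<close> roots there are
  \<open>(k - 1) n - (n - r)\<close> vacant slots. Attaching the root \<open>r\<close> to a vacant slot outside its own tree
  yields all forests with \<open>r - 1\<close> roots. The vacant slots inside the tree of \<open>r\<close> are not available,
  while forests with \<open>n\<close> in the tree of \<open>r\<close> are gained when \<open>r\<close> is attached to the tree of \<open>1\<close>;
  exchanging the labels \<open>1\<close> and \<open>r\<close> shows that loss and gain are equal.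
\<close>

section \<open>Parent maps\<close>

text \<open>A decreasing rank expresses that repeated passage to the parent leaves \<open>N\<close>
  after finitely many steps, so \<open>N\<close> can serve as the set of non-roots of a rooted
  forest. The rank is existential and can therefore be replaced when edges are added.\<close>

definition ranked :: "('a \<Rightarrow> 'a) \<Rightarrow> 'a set \<Rightarrow> bool" where
  "ranked p N \<longleftrightarrow> (\<exists>d::'a \<Rightarrow> nat. \<forall>v\<in>N. d (p v) < d v)"

text \<open>The recursion towards the root is posed for the whole function at once; under
  \<open>ranked\<close> it has exactly one solution, which the choice operator then names.\<close>

definition root_of :: "('a \<Rightarrow> 'a) \<Rightarrow> 'a set \<Rightarrow> 'a \<Rightarrow> 'a" where
  "root_of p N = (SOME h. \<forall>v. h v = (if v \<in> N then h (p v) else v))"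

lemma ranked_induct [consumes 1, case_names step]:
  assumes "ranked p N" and step: "\<And>v. (v \<in> N \<Longrightarrow> P (p v)) \<Longrightarrow> P v"
  shows "P v"
proof -
  obtain d :: "'a \<Rightarrow> nat" where d: "\<forall>v\<in>N. d (p v) < d v"
    using assms(1) ranked_def by metis
  show ?thesis
    by (induction v rule: measure_induct_rule[of d]) (use d step in blast)
qed

text \<open>Well-founded recursion on the rank. It yields the root map and, later, colours computed
  from the roots downwards.\<close>

lemma ranked_rec:
  assumes "ranked p N"
  shows "\<exists>h. \<forall>v. h v = (if v \<in> N then F v (h (p v)) else b v)"
proof -
  obtain d :: "'a \<Rightarrow> nat" where d: "\<forall>v\<in>N. d (p v) < d v"
    using assms(1) ranked_def by metis
  define h where "h = wfrec (measure d) (\<lambda>h v. if v \<in> N then F v (h (p v)) else b v)"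
  have "h v = (if v \<in> N then F v (h (p v)) else b v)" for v
    unfolding h_def by (subst wfrec) (use d in \<open>auto simp: cut_def\<close>)
  then show ?thesis by blast
qed

lemma root_of_rec:
  assumes "ranked p N"
  shows "root_of p N v = (if v \<in> N then root_of p N (p v) else v)"
proof -
  have "\<exists>h. \<forall>v. h v = (if v \<in> N then h (p v) else v)"
    using ranked_rec[OF assms, of "\<lambda>_ x. x" "\<lambda>v. v"] .
  from someI_ex[OF this] show ?thesis unfolding root_of_def by blast
qed

lemma root_of_parent: "ranked p N \<Longrightarrow> v \<in> N \<Longrightarrow> root_of p N (p v) = root_of p N v"
  using root_of_rec[of p N v] by simp

lemma root_of_root: "ranked p N \<Longrightarrow> v \<notin> N \<Longrightarrow> root_of p N v = v"
  using root_of_rec[of p N v] by simp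

text \<open>Being constant along parent steps and fixing the roots characterises the root map, so
  roots in a modified forest are found by checking these two properties.\<close>

lemma root_of_unique_on:
  assumes r: "ranked p N" and V: "p ` N \<subseteq> V" and "v \<in> V"
    and h: "\<And>v. v \<in> N \<Longrightarrow> h (p v) = h v" "\<And>v. v \<in> V - N \<Longrightarrow> h v = v"
  shows "root_of p N v = h v"
  using r \<open>v \<in> V\<close>
proof (induction v rule: ranked_induct)
  case (step v)
  show ?case
  proof (cases "v \<in> N")
    case True
    then have "root_of p N (p v) = h (p v)" using step V by blast
    then show ?thesis using h(1)[OF True] root_of_parent[OF r True] by metis
  next
    case False
    then show ?thesis using h(2)[of v] root_of_root[OF r False] step by simp
  qed
qed

lemmas root_of_unique = root_of_unique_on[where V = UNIV, simplified]

lemma root_of_in: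
  assumes r: "ranked p N" and V: "p ` N \<subseteq> V" and "v \<in> V"
  shows "root_of p N v \<in> V - N"
  using r \<open>v \<in> V\<close>
proof (induction v rule: ranked_induct)
  case (step v)
  show ?case
  proof (cases "v \<in> N")
    case True
    then have "root_of p N (p v) \<in> V - N" using step V by blast
    then show ?thesis using root_of_parent[OF r True] by metis
  next
    case False
    then show ?thesis using root_of_root[OF r False] step by simp
  qed
qed

lemma ranked_cong: "(\<And>v. v \<in> N \<Longrightarrow> p v = q v) \<Longrightarrow> ranked p N = ranked q N"
  unfolding ranked_def by simp

lemma root_of_cong:
  assumes "\<And>v. v \<in> N \<Longrightarrow> p v = q v"
  shows "root_of p N = root_of q N"
proof -
  have "(\<lambda>h v. h v = (if v \<in> N then h (p v) else v)) = (\<lambda>h v. h v = (if v \<in> N then h (q v) else v))"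
    using assms by (auto simp: fun_eq_iff)
  then show ?thesis unfolding root_of_def by meson
qed

section \<open>Attaching a root to another vertex\<close>

lemma ranked_link_iff:
  assumes a: "a \<notin> N"
  shows "ranked (p(a := x)) (insert a N) \<longleftrightarrow> ranked p N \<and> root_of p N x \<noteq> a" (is "?L \<longleftrightarrow> ?R")
proof
  assume ?L
  then obtain d :: "'a \<Rightarrow> nat" where d: "\<forall>v\<in>insert a N. d ((p(a := x)) v) < d v"
    unfolding ranked_def by metis
  have dN: "d (p v) < d v" if "v \<in> N" for v using d a that by (metis fun_upd_apply insertI2)
  then have r: "ranked p N" unfolding ranked_def by blast
  \<comment> \<open>Ranks do not rise on the way to the root; were \<open>a\<close> the root of
    \<open>x\<close>, this would give \<open>d a\<close> \<le> \<open>d x\<close>, against the new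
    edge from \<open>a\<close> to \<open>x\<close>.\<close>
  have "d (root_of p N v) \<le> d v" for v
    using r
  proof (induction v rule: ranked_induct)
    case (step v)
    show ?case
    proof (cases "v \<in> N")
      case True
      then show ?thesis using step dN[OF True] root_of_parent[OF r True] by simp
    next
      case False
      then show ?thesis using root_of_root[OF r False] by simp
    qed
  qed
  moreover have "d x < d a" using d by simp
  ultimately show ?R using r by (metis not_less)
next
  assume R: ?R
  then obtain d :: "'a \<Rightarrow> nat" where d: "\<forall>v\<in>N. d (p v) < d v"
    unfolding ranked_def by metis
  \<comment> \<open>The whole tree of \<open>a\<close> is lifted by \<open>d x + 1\<close>.
    Comparisons inside a tree are unaffected, and \<open>a\<close> now lies above \<open>x\<close>,
    which belongs to another tree and is not lifted.\<close>
  define d' where "d' v = d v + (if root_of p N v = a then d x + 1 else 0)" for v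
  have "d' ((p(a := x)) v) < d' v" if "v \<in> insert a N" for v
  proof (cases "v = a")
    case True
    then show ?thesis using R a by (simp add: d'_def root_of_root)
  next
    case False
    then show ?thesis using R d that by (simp add: d'_def root_of_parent)
  qed
  then show ?L unfolding ranked_def by blast
qed

lemma root_of_link:
  assumes a: "a \<notin> N" and r: "ranked p N" and x: "root_of p N x \<noteq> a"
  shows "root_of (p(a := x)) (insert a N) v
    = (if root_of p N v = a then root_of p N x else root_of p N v)"
proof (rule root_of_unique)
  show "ranked (p(a := x)) (insert a N)" using assms ranked_link_iff by metis
qed (use assms in \<open>auto simp: root_of_parent root_of_root\<close>)

section \<open>Counting slot forests\<close>

text \<open>Each vertex has slots indexed by \<open>S\<close>, each of which carries at most one child.\<close>

definition slot_forests :: "'a set \<Rightarrow> 'b set \<Rightarrow> 'a set \<Rightarrow> ('a \<Rightarrow> 'a \<times> 'b) set" where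
  "slot_forests V S R = {f \<in> (V - R) \<rightarrow>\<^sub>E V \<times> S. inj_on f (V - R) \<and> ranked (fst \<circ> f) (V - R)}"

definition vacant :: "'a set \<Rightarrow> 'b set \<Rightarrow> 'a set \<Rightarrow> ('a \<Rightarrow> 'a \<times> 'b) \<Rightarrow> ('a \<times> 'b) set" where
  "vacant V S R f = V \<times> S - f ` (V - R)"

definition slot_root :: "'a set \<Rightarrow> 'a set \<Rightarrow> ('a \<Rightarrow> 'a \<times> 'b) \<Rightarrow> 'a \<Rightarrow> 'a" where
  "slot_root V R f = root_of (fst \<circ> f) (V - R)"

lemma finite_slot_forests: "finite V \<Longrightarrow> finite S \<Longrightarrow> finite (slot_forests V S R)"
  unfolding slot_forests_def by (rule finite_subset[of _ "(V - R) \<rightarrow>\<^sub>E V \<times> S"]) (auto intro: finite_PiE)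

text \<open>Injectivity gives every non-root a slot of its own, so the number of vacant slots is the
  same for all forests. This constant becomes the factor of the recursion.\<close>

lemma card_vacant:
  assumes "finite V" "finite S" "R \<subseteq> V" and f: "f \<in> slot_forests V S R"
  shows "int (card (vacant V S R f)) = int (card V) * int (card S) - int (card V) + int (card R)"
proof -
  have sub: "f ` (V - R) \<subseteq> V \<times> S" using f unfolding slot_forests_def by blast
  have fin: "finite (V \<times> S)" using assms by simp
  have "card (f ` (V - R)) = card (V - R)" using f by (simp add: slot_forests_def card_image)
  moreover have "card (f ` (V - R)) \<le> card (V \<times> S)" using card_mono[OF fin sub] .
  moreover have "card (vacant V S R f) = card (V \<times> S) - card (f ` (V - R))"
    unfolding vacant_def using sub fin by (meson card_Diff_subset finite_subset)
  moreover have "card (V - R) = card V - card R" "card R \<le> card V"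
    using assms by (auto simp: card_Diff_subset card_mono finite_subset)
  ultimately show ?thesis by (simp add: card_cartesian_product of_nat_diff)
qed

text \<open>The inverse cuts \<open>b\<close> off its parent and remembers the slot it occupied.
  Vacancy of the slot corresponds to injectivity, and a slot outside the tree of \<open>b\<close> to
  the absence of cycles.\<close>

lemma bij_betw_link:
  assumes b: "b \<in> R" "R \<subseteq> V"
  shows "bij_betw (\<lambda>(f, s). f(b := s))
    {(f, s). f \<in> slot_forests V S R \<and> s \<in> vacant V S R f \<and> slot_root V R f (fst s) \<noteq> b}
    (slot_forests V S (R - {b}))"
    (is "bij_betw ?h ?A ?B")
proof (rule bij_betw_byWitness[where f' = "\<lambda>g. (restrict g (V - R), g b)"])
  have N: "V - (R - {b}) = insert b (V - R)" "b \<notin> V - R" using b by auto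
  have upd: "fst \<circ> f(b := s) = (fst \<circ> f)(b := fst s)" for f :: "'a \<Rightarrow> 'a \<times> 'b" and s by auto
  show "\<forall>a\<in>?A. (restrict (?h a) (V - R), ?h a b) = a"
    using N by (auto simp: slot_forests_def PiE_iff extensional_def fun_eq_iff)
  show "\<forall>g\<in>?B. ?h (restrict g (V - R), g b) = g"
    using N by (auto simp: slot_forests_def PiE_iff extensional_def fun_eq_iff)
  show "?h ` ?A \<subseteq> ?B"
  proof clarify
    fix f x s assume f: "f \<in> slot_forests V S R" and s: "(x, s) \<in> vacant V S R f"
      and x: "slot_root V R f (fst (x, s)) \<noteq> b"
    have "f(b := (x, s)) \<in> V - (R - {b}) \<rightarrow>\<^sub>E V \<times> S"
      unfolding N(1) using f s N(2) by (intro PiE_fun_upd) (auto simp: slot_forests_def vacant_def)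
    moreover have "inj_on (f(b := (x, s))) (V - (R - {b}))"
    proof -
      have "inj_on f (V - R)" "(x, s) \<notin> f ` (V - R)"
        using f s by (auto simp: slot_forests_def vacant_def)
      then have "inj_on (f(b := (x, s))) (V - R)" "(x, s) \<notin> f(b := (x, s)) ` (V - R)"
        using N(2) by (auto simp: inj_on_def)
      then show ?thesis unfolding N(1) using N(2) by simp
    qed
    moreover have "ranked (fst \<circ> f(b := (x, s))) (V - (R - {b}))"
      unfolding N(1) upd ranked_link_iff[OF N(2)] using f x by (simp add: slot_forests_def slot_root_def)
    ultimately show "f(b := (x, s)) \<in> ?B" unfolding slot_forests_def by blast
  qed
  show "(\<lambda>g. (restrict g (V - R), g b)) ` ?B \<subseteq> ?A"
  proof (rule image_subsetI)
    fix g assume g: "g \<in> ?B"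
    let ?f = "restrict g (V - R)"
    have g': "g = ?f(b := g b)"
      using g N by (auto simp: slot_forests_def PiE_iff extensional_def fun_eq_iff)
    have "ranked (fst \<circ> ?f(b := g b)) (insert b (V - R))"
      using g g' N by (simp add: slot_forests_def)
    then have "ranked (fst \<circ> ?f) (V - R)" "slot_root V R ?f (fst (g b)) \<noteq> b"
      unfolding upd ranked_link_iff[OF N(2)] slot_root_def by auto
    moreover have "?f \<in> V - R \<rightarrow>\<^sub>E V \<times> S" "inj_on ?f (V - R)" "g b \<in> vacant V S R ?f"
      using g N b by (auto simp: slot_forests_def PiE_iff inj_on_def vacant_def)
    ultimately show "(?f, g b) \<in> ?A"
      unfolding slot_forests_def by blast
  qed
qed

lemma slot_root_link:
  assumes "b \<in> R" "R \<subseteq> V" "f \<in> slot_forests V S R" "slot_root V R f (fst s) \<noteq> b"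
  shows "slot_root V (R - {b}) (f(b := s)) y
    = (if slot_root V R f y = b then slot_root V R f (fst s) else slot_root V R f y)"
proof -
  have "V - (R - {b}) = insert b (V - R)" "fst \<circ> f(b := s) = (fst \<circ> f)(b := fst s)"
    using assms by auto
  moreover have "b \<notin> V - R" "ranked (fst \<circ> f) (V - R)"
    using assms by (auto simp: slot_forests_def)
  ultimately show ?thesis using assms(4) unfolding slot_root_def by (simp only: root_of_link if_True not_False_eq_True)
qed

text \<open>The transposition moves only roots, and roots are not arguments of \<open>f\<close>.
  Hence exchanging the two labels amounts to changing the values of \<open>f\<close>, and the trees
  at \<open>a\<close> and \<open>b\<close> trade their roots.\<close>

lemma relabel_slot_forest:
  fixes f :: "'a \<Rightarrow> 'a \<times> 'b"
  assumes ab: "a \<in> R" "b \<in> R" "R \<subseteq> V" and f: "f \<in> slot_forests V S R"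
  defines "t \<equiv> map_prod (transpose a b) (id :: 'b \<Rightarrow> 'b)"
  defines "f' \<equiv> restrict (t \<circ> f) (V - R)"
  shows "f' \<in> slot_forests V S R"
    and "slot_root V R f' v = transpose a b (slot_root V R f (transpose a b v))"
    and "s \<in> vacant V S R f \<Longrightarrow> t s \<in> vacant V S R f'"
proof -
  let ?t = "transpose a b"
  have tfix: "?t v = v" if "v \<in> V - R" for v
    using that ab by (metis DiffD2 transpose_apply_other)
  have tfix': "?t v \<notin> V - R" if "v \<notin> V - R" for v
    using that by (metis tfix transpose_involutory)
  have tV: "?t v \<in> V" if "v \<in> V" for v
    using that ab unfolding transpose_def by auto
  have inj: "inj t" unfolding t_def by (simp add: prod.inj_map inj_transpose)
  have tS: "t s \<in> V \<times> S" if "s \<in> V \<times> S" for s using that tV unfolding t_def by auto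
  have fr: "fst (f' v) = ?t (fst (f v))" if "v \<in> V - R" for v using that unfolding f'_def t_def by simp
  have rf: "ranked (fst \<circ> f) (V - R)" using f by (simp add: slot_forests_def)
  then obtain d :: "'a \<Rightarrow> nat" where d: "\<forall>v\<in>V - R. d (fst (f v)) < d v"
    unfolding ranked_def by auto
  \<comment> \<open>The old rank read through the transposition is a rank for the relabelled
    forest.\<close>
  have "\<forall>v\<in>V - R. (d \<circ> ?t) ((fst \<circ> f') v) < (d \<circ> ?t) v"
    using d tfix fr by simp
  then have r: "ranked (fst \<circ> f') (V - R)" unfolding ranked_def by blast
  have "f' \<in> V - R \<rightarrow>\<^sub>E V \<times> S"
    unfolding f'_def using f tS by (auto simp: slot_forests_def PiE_iff simp del: mem_Times_iff)
  moreover have "inj_on f' (V - R)"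
  proof -
    have "inj_on (t \<circ> f) (V - R)"
      using f inj by (intro comp_inj_on) (auto simp: slot_forests_def intro: inj_on_subset)
    then show ?thesis unfolding f'_def by (simp add: inj_on_def)
  qed
  ultimately show "f' \<in> slot_forests V S R" using r by (simp add: slot_forests_def)
  show "slot_root V R f' v = ?t (slot_root V R f (?t v))"
    unfolding slot_root_def[of V R f']
  proof (rule root_of_unique[OF r])
    fix v assume v: "v \<in> V - R"
    have "slot_root V R f (fst (f v)) = slot_root V R f v"
      using root_of_parent[OF rf v] by (simp add: slot_root_def)
    then show "?t (slot_root V R f (?t ((fst \<circ> f') v))) = ?t (slot_root V R f (?t v))"
      using v tfix fr by simp
  next
    fix v assume "v \<notin> V - R"
    then show "?t (slot_root V R f (?t v)) = v"
      using tfix' by (simp add: root_of_root[OF rf] slot_root_def)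
  qed
  show "t s \<in> vacant V S R f'" if "s \<in> vacant V S R f"
  proof -
    have "f' ` (V - R) = t ` f ` (V - R)" unfolding f'_def by auto
    then show ?thesis using that tS inj unfolding vacant_def by (metis Diff_iff inj_image_mem_iff)
  qed
qed

text \<open>Relabelling a forest together with its marked slot is an involution that exchanges the
  two sets, since the non-root \<open>y\<close> keeps its name.\<close>

lemma card_swap_roots:
  assumes ab: "a \<in> R" "b \<in> R" "R \<subseteq> V" and y: "y \<in> V - R" and fin: "finite V" "finite S"
  shows "card {(f, s). f \<in> slot_forests V S R \<and> s \<in> vacant V S R f
      \<and> slot_root V R f y = a \<and> slot_root V R f (fst s) = b}
    = card {(f, s). f \<in> slot_forests V S R \<and> s \<in> vacant V S R f
      \<and> slot_root V R f y = b \<and> slot_root V R f (fst s) = a}"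
    (is "card (?X a b) = card (?X b a)")
proof -
  let ?h = "\<lambda>(f, s). (restrict (map_prod (transpose a b) id \<circ> f) (V - R), map_prod (transpose a b) id s)"
  have yt: "transpose a b y = y" using y ab by (metis DiffD2 transpose_apply_other)
  have sub: "?h z \<in> ?X d c" if z: "z \<in> ?X c d" and cd: "{c, d} = {a, b}" for c d z
  proof -
    obtain f s where fs: "z = (f, s)" "f \<in> slot_forests V S R" "s \<in> vacant V S R f"
      "slot_root V R f y = c" "slot_root V R f (fst s) = d"
      using z by blast
    have "transpose a b c = d" "transpose a b d = c"
      using cd by (auto simp: doubleton_eq_iff)
    then show ?thesis
      unfolding fs(1) using relabel_slot_forest[OF ab fs(2)] fs yt by (simp add: fst_map_prod)
  qed
  have inv: "?h (?h z) = z" if z: "z \<in> ?X a b \<union> ?X b a" for z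
  proof -
    obtain f x s where fs: "z = (f, (x, s))" and f: "f \<in> slot_forests V S R" using z by auto
    have "restrict (map_prod (transpose a b) id \<circ> restrict (map_prod (transpose a b) id \<circ> f) (V - R)) (V - R) v = f v" for v
      using f by (cases "f v") (auto simp: slot_forests_def PiE_iff extensional_def)
    then show ?thesis unfolding fs by auto
  qed
  have "bij_betw ?h (?X a b) (?X b a)"
  proof (rule bij_betw_byWitness[where f' = ?h])
    show "\<forall>z\<in>?X a b. ?h (?h z) = z" by (rule ballI, rule inv, rule UnI1)
    show "\<forall>z\<in>?X b a. ?h (?h z) = z" by (rule ballI, rule inv, rule UnI2)
    show "?h ` ?X a b \<subseteq> ?X b a" by (rule image_subsetI) (rule sub, auto)
    show "?h ` ?X b a \<subseteq> ?X a b" by (rule image_subsetI) (rule sub, auto)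
  qed
  then show ?thesis by (rule bij_betw_same_card)
qed

theorem card_slot_forests_merge:
  assumes ab: "a \<in> R" "b \<in> R" "a \<noteq> b" "R \<subseteq> V" and y: "y \<in> V - R" and fin: "finite V" "finite S"
  shows "int (card {f \<in> slot_forests V S (R - {b}). slot_root V (R - {b}) f y = a})
    = (int (card V) * int (card S) - int (card V) + int (card R))
      * int (card {f \<in> slot_forests V S R. slot_root V R f y = a})"
proof -
  let ?F = "slot_forests V S R" and ?v = "vacant V S R" and ?r = "slot_root V R"
  let ?h = "\<lambda>(f, s). f(b := s)"
  \<comment> \<open>After linking, \<open>y\<close> lies below \<open>a\<close> in two cases: it did
    so before (\<open>X\<close>), or it lay below \<open>b\<close>, which was attached to the tree
    of \<open>a\<close> (\<open>Y\<close>). The pairs in \<open>Z\<close> are those with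
    \<open>y\<close> below \<open>a\<close> whose slot is forbidden because it lies in the tree of
    \<open>b\<close>.\<close>
  define X where "X = {(f, s). f \<in> ?F \<and> s \<in> ?v f \<and> ?r f y = a \<and> ?r f (fst s) \<noteq> b}"
  define Y where "Y = {(f, s). f \<in> ?F \<and> s \<in> ?v f \<and> ?r f y = b \<and> ?r f (fst s) = a}"
  define Z where "Z = {(f, s). f \<in> ?F \<and> s \<in> ?v f \<and> ?r f y = a \<and> ?r f (fst s) = b}"
  define A where "A = {f \<in> ?F. ?r f y = a}"
  have finv: "finite (?v f)" for f using fin by (simp add: vacant_def)
  have finF: "finite ?F" using fin by (rule finite_slot_forests)
  have finS: "finite (Sigma ?F ?v)" using finF finv by blast
  have fXYZ: "finite X" "finite Y" "finite Z"
    unfolding X_def Y_def Z_def by (auto intro: finite_subset[OF _ finS])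
  let ?B = "{f \<in> slot_forests V S (R - {b}). slot_root V (R - {b}) f y = a}"
  have "bij_betw ?h (X \<union> Y) ?B"
  proof (rule bij_betw_subset[OF bij_betw_link[OF ab(2,4), of S]])
    show "X \<union> Y \<subseteq> {(f, s). f \<in> ?F \<and> s \<in> ?v f \<and> ?r f (fst s) \<noteq> b}"
      using ab unfolding X_def Y_def by auto
    have eq: "X \<union> Y = {z \<in> {(f, s). f \<in> ?F \<and> s \<in> ?v f \<and> ?r f (fst s) \<noteq> b}.
        slot_root V (R - {b}) (?h z) y = a}"
      (is "_ = {z \<in> ?D. _}")
    proof (rule set_eqI)
      fix z
      show "z \<in> X \<union> Y \<longleftrightarrow> z \<in> {z \<in> ?D. slot_root V (R - {b}) (?h z) y = a}"
      proof (cases "z \<in> ?D")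
        case True
        then obtain f s where z: "z = (f, s)" "f \<in> ?F" "s \<in> ?v f" "?r f (fst s) \<noteq> b" by blast
        then show ?thesis
          using slot_root_link[OF ab(2,4) z(2,4), of y] ab(3) unfolding z X_def Y_def by auto
      next
        case False
        then show ?thesis using ab(3) unfolding X_def Y_def by auto
      qed
    qed
    have "?h ` {z \<in> M. P (?h z)} = {g \<in> ?h ` M. P g}" for M P by blast
    then show "?h ` (X \<union> Y) = ?B"
      unfolding eq bij_betw_imp_surj_on[OF bij_betw_link[OF ab(2,4), of S], symmetric] .
  qed
  then have "card ?B = card (X \<union> Y)" by (rule bij_betw_same_card[symmetric])
  also have "\<dots> = card X + card Y"
    using fXYZ ab by (intro card_Un_disjoint) (auto simp: X_def Y_def)
  \<comment> \<open>The gain \<open>Y\<close> and the loss \<open>Z\<close> differ only by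
    exchanging the roots \<open>a\<close> and \<open>b\<close>.\<close>
  also have "card Y = card Z"
    unfolding Y_def Z_def using card_swap_roots[OF ab(1,2,4) y fin] by simp
  also have "card X + card Z = card (X \<union> Z)"
    using fXYZ by (intro card_Un_disjoint[symmetric]) (auto simp: X_def Z_def)
  \<comment> \<open>Together \<open>X\<close> and \<open>Z\<close> impose no condition on the slot,
    so each forest in \<open>A\<close> contributes all its vacant slots.\<close>
  also have "X \<union> Z = Sigma A ?v" unfolding X_def Z_def A_def by auto
  also have "card \<dots> = (\<Sum>f\<in>A. card (?v f))"
    using finF finv by (intro card_SigmaI) (auto simp: A_def)
  finally have "int (card ?B) = (\<Sum>f\<in>A. int (card (?v f)))" by simp
  also have "\<dots> = (\<Sum>f\<in>A. int (card V) * int (card S) - int (card V) + int (card R))"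
    by (intro sum.cong refl card_vacant fin ab) (simp add: A_def)
  finally show ?thesis by (simp add: A_def mult.commute)
qed

section \<open>Relative colours\<close>

text \<open>A root has no parent edge; the default \<open>k\<close> makes the condition that edges
  at a root avoid \<open>k\<close> an instance of the condition at every other vertex.\<close>

definition parent_color :: "nat \<Rightarrow> 'a set \<Rightarrow> ('a \<Rightarrow> 'a \<times> nat) \<Rightarrow> 'a \<Rightarrow> nat" where
  "parent_color k N g v = (if v \<in> N then snd (g v) else k)"

text \<open>Properness is split in two: injectivity separates the edges to siblings, and the last
  conjunct separates an edge from the one above it.\<close>

definition colored_forests :: "'a set \<Rightarrow> nat \<Rightarrow> 'a set \<Rightarrow> ('a \<Rightarrow> 'a \<times> nat) set" where
  "colored_forests V k R = {g \<in> (V - R) \<rightarrow>\<^sub>E V \<times> {1..k}. inj_on g (V - R)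
     \<and> ranked (fst \<circ> g) (V - R)
     \<and> (\<forall>v\<in>V - R. snd (g v) \<noteq> parent_color k (V - R) g (fst (g v)))}"

text \<open>The children of a vertex use the colours other than that of the edge to its parent;
  transposing this colour with \<open>k\<close> turns them into the first \<open>k - 1\<close> colours.\<close>

definition relative_colors :: "nat \<Rightarrow> 'a set \<Rightarrow> ('a \<Rightarrow> 'a \<times> nat) \<Rightarrow> 'a \<Rightarrow> 'a \<times> nat" where
  "relative_colors k N g = (\<lambda>v\<in>N. (fst (g v), transpose k (parent_color k N g (fst (g v))) (snd (g v))))"

lemma transpose_in_iff:
  "a \<in> A \<Longrightarrow> b \<in> A \<Longrightarrow> transpose a b x \<in> A \<longleftrightarrow> x \<in> A"
  unfolding transpose_def by auto

lemma transpose_eq_first_iff: "transpose a b x = a \<longleftrightarrow> x = b"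
  unfolding transpose_def by auto

lemma bij_betw_relative_colors:
  assumes k: "1 \<le> k"
  shows "bij_betw (relative_colors k (V - R)) (colored_forests V k R) (slot_forests V {1..k - 1} R)"
proof (rule bij_betw_imageI)
  define N where "N = V - R"
  let ?c = "parent_color k N" and ?h = "relative_colors k N"
  have S: "x \<in> {1..k - 1} \<longleftrightarrow> x \<in> {1..k} \<and> x \<noteq> k" for x using k by auto
  have pc: "?c g v \<in> {1..k}" if "g \<in> N \<rightarrow>\<^sub>E V \<times> {1..k}" for g v
    using that k by (auto simp: parent_color_def PiE_iff)
  have hv: "fst (?h g v) = fst (g v)" "snd (?h g v) = transpose k (?c g (fst (g v))) (snd (g v))"
    if "v \<in> N" for g v using that by (auto simp: relative_colors_def)
  show "inj_on (relative_colors k (V - R)) (colored_forests V k R)"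
    unfolding N_def[symmetric]
  proof (rule inj_onI)
    fix g g' assume g: "g \<in> colored_forests V k R" "g' \<in> colored_forests V k R" and eq: "?h g = ?h g'"
    have p: "fst (g v) = fst (g' v)" if "v \<in> N" for v
      using hv(1)[OF that] eq by metis
    have r: "ranked (fst \<circ> g) N" using g by (simp add: colored_forests_def N_def)
    \<comment> \<open>Going down from the roots, both maps apply the same transposition at the
      parent, so it can be cancelled.\<close>
    have c: "?c g v = ?c g' v" for v
      using r
    proof (induction v rule: ranked_induct)
      case (step v)
      show ?case
      proof (cases "v \<in> N")
        case True
        then have "transpose k (?c g (fst (g v))) (snd (g v)) = transpose k (?c g (fst (g v))) (snd (g' v))"
          using hv(2)[of v g] hv(2)[of v g'] eq step p[of v] by simp
        then show ?thesis using True by (simp add: parent_color_def inj_eq[OF inj_transpose])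
      qed (simp add: parent_color_def)
    qed
    have "snd (g v) = snd (g' v)" if "v \<in> N" for v using c[of v] that by (simp add: parent_color_def)
    with p have "g v = g' v" if "v \<in> N" for v using that by (simp add: prod_eq_iff)
    moreover have "g \<in> N \<rightarrow>\<^sub>E V \<times> {1..k}" "g' \<in> N \<rightarrow>\<^sub>E V \<times> {1..k}"
      using g by (simp_all add: colored_forests_def N_def)
    ultimately show "g = g'" by (metis PiE_ext)
  qed
  have inj_iff: "inj_on (?h g) N \<longleftrightarrow> inj_on g N" for g
  proof -
    have "?h g v = ?h g w \<longleftrightarrow> g v = g w" if "v \<in> N" "w \<in> N" for v w
      using that hv[of v g] hv[of w g] by (auto simp: prod_eq_iff inj_eq[OF inj_transpose])
    then show ?thesis by (simp add: inj_on_def)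
  qed
  have rank_iff: "ranked (fst \<circ> ?h g) N \<longleftrightarrow> ranked (fst \<circ> g) N" for g
    by (rule ranked_cong) (simp add: hv)
  \<comment> \<open>The transposed colour is \<open>k\<close> exactly when the original is the
    parent colour, so the \<open>k - 1\<close> slots match the colours allowed at the
    parent.\<close>
  have hS: "?h g v \<in> V \<times> {1..k - 1} \<longleftrightarrow> g v \<in> V \<times> {1..k} \<and> snd (g v) \<noteq> ?c g (fst (g v))"
    if g: "\<And>v. ?c g v \<in> {1..k}" and v: "v \<in> N" for g v
  proof -
    have "snd (?h g v) \<in> {1..k} \<longleftrightarrow> snd (g v) \<in> {1..k}"
      unfolding hv(2)[OF v] using g k by (intro transpose_in_iff) auto
    moreover have "snd (?h g v) = k \<longleftrightarrow> snd (g v) = ?c g (fst (g v))"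
      unfolding hv(2)[OF v] by (rule transpose_eq_first_iff)
    ultimately show ?thesis using hv(1)[OF v] S by (auto simp: mem_Times_iff)
  qed
  have ext: "?h g \<in> extensional N" for g by (simp add: relative_colors_def)
  show "relative_colors k (V - R) ` colored_forests V k R = slot_forests V {1..k - 1} R"
    unfolding N_def[symmetric]
  proof (intro equalityI image_subsetI subsetI)
    fix g assume g: "g \<in> colored_forests V k R"
    then have g': "g \<in> N \<rightarrow>\<^sub>E V \<times> {1..k}" by (simp add: colored_forests_def N_def)
    have "?h g v \<in> V \<times> {1..k - 1}" if "v \<in> N" for v
      using g g' hS[OF pc[OF g'] that] that by (auto simp: colored_forests_def N_def)
    then have "?h g \<in> N \<rightarrow>\<^sub>E V \<times> {1..k - 1}" using ext by (simp add: PiE_iff)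
    then show "?h g \<in> slot_forests V {1..k - 1} R"
      using g inj_iff rank_iff by (simp add: slot_forests_def colored_forests_def N_def)
  next
    fix f assume f: "f \<in> slot_forests V {1..k - 1} R"
    then have r: "ranked (fst \<circ> f) N" by (simp add: slot_forests_def N_def)
    \<comment> \<open>Absolute colours are recovered from the top: once the colour above the parent
      is known, its transposition is undone. The start value \<open>k\<close> is the default of
      \<open>parent_color\<close>.\<close>
    from ranked_rec[OF this, of "\<lambda>v x. transpose k x (snd (f v))" "\<lambda>_. k"]
    obtain c where c: "\<And>v. c v = (if v \<in> N then transpose k (c (fst (f v))) (snd (f v)) else k)"
      unfolding comp_apply by blast
    define g where "g = (\<lambda>v\<in>N. (fst (f v), c v))"
    have cg: "?c g = c" using c by (auto simp: parent_color_def g_def fun_eq_iff)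
    have fS: "f v \<in> V \<times> {1..k - 1}" if "v \<in> N" for v
      using f that unfolding slot_forests_def N_def by blast
    have ck: "c v \<in> {1..k}" for v
      using r
    proof (induction v rule: ranked_induct)
      case (step v)
      show ?case
      proof (cases "v \<in> N")
        case True
        have "snd (f v) \<in> {1..k}" using fS[OF True] by auto
        then have "transpose k (c (fst (f v))) (snd (f v)) \<in> {1..k}"
          using step[OF True] k transpose_in_iff[of k "{1..k}" "c (fst (f v))" "snd (f v)"] by auto
        then show ?thesis using True c[of v] by simp
      next
        case False
        then show ?thesis using c[of v] k by simp
      qed
    qed
    have hg: "?h g = f"
    proof
      fix v show "?h g v = f v"
      proof (cases "v \<in> N")
        case True
        then show ?thesis using hv[OF True, of g] c[of v] cg by (simp add: g_def prod_eq_iff)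
      next
        case False
        then have "f v = undefined" using f unfolding slot_forests_def N_def by (auto intro: PiE_arb)
        then show ?thesis using False by (simp add: relative_colors_def)
      qed
    qed
    have "g v \<in> V \<times> {1..k} \<and> snd (g v) \<noteq> ?c g (fst (g v))" if "v \<in> N" for v
      using hS[of g v] cg ck hg fS that by metis
    moreover have "g \<in> extensional N" by (simp add: g_def)
    ultimately have "g \<in> colored_forests V k R"
      using inj_iff[of g] rank_iff[of g] hg f
      by (simp add: colored_forests_def slot_forests_def N_def[symmetric] PiE_iff)
    then show "f \<in> ?h ` colored_forests V k R" using hg by blast
  qed
qed

lemma slot_root_relative_colors: "slot_root V R (relative_colors k (V - R) g) = slot_root V R g"
  unfolding slot_root_def by (rule root_of_cong) (simp add: relative_colors_def)

lemma card_colored_forests_root: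
  assumes "1 \<le> k"
  shows "card {g \<in> colored_forests V k R. slot_root V R g y = a}
    = card {f \<in> slot_forests V {1..k - 1} R. slot_root V R f y = a}"
proof (rule bij_betw_same_card)
  note b = bij_betw_relative_colors[OF assms, of V R]
  let ?h = "relative_colors k (V - R)"
  show "bij_betw ?h {g \<in> colored_forests V k R. slot_root V R g y = a}
      {f \<in> slot_forests V {1..k - 1} R. slot_root V R f y = a}"
  proof (rule bij_betw_subset[OF b])
    show "?h ` {g \<in> colored_forests V k R. slot_root V R g y = a}
      = {f \<in> slot_forests V {1..k - 1} R. slot_root V R f y = a}"
      unfolding bij_betw_imp_surj_on[OF b, symmetric] by (auto simp: slot_root_relative_colors)
  qed blast
qed

section \<open>Trees as parent maps\<close>

definition parent_edges :: "('a \<Rightarrow> 'a) \<Rightarrow> 'a set \<Rightarrow> 'a set set" where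
  "parent_edges p N = (\<lambda>v. {v, p v}) ` N"

lemma ranked_irrefl: "ranked p N \<Longrightarrow> v \<in> N \<Longrightarrow> p v \<noteq> v"
  unfolding ranked_def by (metis less_irrefl)

lemma ranked_asym: "ranked p N \<Longrightarrow> v \<in> N \<Longrightarrow> p v \<in> N \<Longrightarrow> p (p v) \<noteq> v"
  unfolding ranked_def by (metis less_asym)

text \<open>Two different vertices with the same parent edge would be parents of each other.\<close>

lemma inj_on_parent_edge: "ranked p N \<Longrightarrow> inj_on (\<lambda>v. {v, p v}) N"
  using ranked_asym[of p N] by (auto intro!: inj_onI simp: doubleton_eq_iff)

lemma root_of_edge:
  "ranked p N \<Longrightarrow> {u, v} \<in> parent_edges p N \<Longrightarrow> root_of p N u = root_of p N v"
  by (auto simp: parent_edges_def doubleton_eq_iff root_of_parent)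

lemma root_of_walk:
  assumes "ranked p N" and "successively (\<lambda>x y. {x, y} \<in> parent_edges p N) q" and "z \<in> set q"
  shows "root_of p N z = root_of p N (hd q)"
  using assms(2,3)
proof (induction q rule: induct_list012)
  case (3 x y zs)
  then show ?case using root_of_edge[OF assms(1), of x y] by auto
qed auto

text \<open>The non-roots being fixed, the edges determine their orientation. If \<open>q\<close>
  reversed the edge from \<open>v\<close> to \<open>p v\<close>, then \<open>q (p v) = v\<close>; by
  induction \<open>p (p v) = v\<close> as well, which the rank forbids.\<close>

lemma parent_edges_inj:
  assumes p: "ranked p N" and q: "ranked q N" and eq: "parent_edges p N = parent_edges q N" and "v \<in> N"
  shows "p v = q v"
  using p \<open>v \<in> N\<close>
proof (induction v rule: ranked_induct)
  case (step v)
  have "{v, p v} \<in> parent_edges q N" using step eq by (auto simp: parent_edges_def)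
  then obtain w where w: "w \<in> N" "{v, p v} = {w, q w}" by (auto simp: parent_edges_def)
  show ?case
  proof (cases "w = v")
    case True
    then show ?thesis using w by (metis doubleton_eq_iff)
  next
    case False
    then have "w = p v" "q w = v" using w by (auto simp: doubleton_eq_iff)
    then show ?thesis using step w ranked_asym[OF p] by metis
  qed
qed

section \<open>Connectedness and acyclicity of parent edges\<close>

lemma path_between_mono: "path_between E u q v \<Longrightarrow> E \<subseteq> F \<Longrightarrow> path_between F u q v"
  unfolding path_between_def using successively_mono[of "\<lambda>x y. {x, y} \<in> E" q "\<lambda>x y. {x, y} \<in> F"]
  by blast

text \<open>If \<open>x\<close> already occurs on the path, the part before it is dropped instead of
  prepending \<open>x\<close>, which keeps the vertices distinct.\<close>

lemma path_between_Cons: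
  assumes q: "path_between E y q v" and xy: "{x, y} \<in> E"
  shows "\<exists>q'. path_between E x q' v"
proof (cases "x \<in> set q")
  case True
  then obtain as bs where ab: "q = as @ x # bs" by (meson split_list)
  have "path_between E x (x # bs) v"
    using q unfolding ab path_between_def by (simp add: successively_append_iff)
  then show ?thesis by blast
next
  case False
  then have "path_between E x (x # q) v"
    using q xy unfolding path_between_def by (simp add: successively_Cons)
  then show ?thesis by blast
qed

lemma rtrancl_imp_path_between:
  assumes "(u, v) \<in> {(x, y). {x, y} \<in> E}\<^sup>*"
  shows "\<exists>q. path_between E u q v"
  using assms
proof (induction rule: converse_rtrancl_induct)
  case base
  have "path_between E v [v] v" by (simp add: path_between_def)
  then show ?case by (rule exI)
next
  case (step x y)
  then obtain q where "path_between E y q v" by (elim exE)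
  then show ?case using step(1) by (intro path_between_Cons) auto
qed

lemma path_between_same_root:
  assumes r: "ranked p N" and eq: "root_of p N u = root_of p N v" and V: "p ` N \<subseteq> V" "u \<in> V" "v \<in> V"
  shows "\<exists>q. path_between {e \<in> parent_edges p N. e \<subseteq> {x \<in> V. root_of p N x = root_of p N u}} u q v"
proof -
  let ?W = "{x \<in> V. root_of p N x = root_of p N u}"
  let ?r = "{(x, y). {x, y} \<in> {e \<in> parent_edges p N. e \<subseteq> ?W}}"
  \<comment> \<open>Climbing to the root never leaves the tree. By symmetry the climb from
    \<open>v\<close> can be reversed and joined to the one from \<open>u\<close>.\<close>
  have *: "(x, root_of p N u) \<in> ?r\<^sup>*" if "x \<in> ?W" for x
    using r that
  proof (induction x rule: ranked_induct)
    case (step x)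
    show ?case
    proof (cases "x \<in> N")
      case True
      then have "p x \<in> ?W" using step V by (auto simp: root_of_parent[OF r])
      moreover from this have "(x, p x) \<in> ?r" using True step by (auto simp: parent_edges_def)
      ultimately show ?thesis using step(1)[OF True] by (meson converse_rtrancl_into_rtrancl)
    next
      case False
      then show ?thesis using step by (simp add: root_of_root[OF r])
    qed
  qed
  have "sym ?r" by (auto simp: sym_def insert_commute)
  then have "(root_of p N u, v) \<in> ?r\<^sup>*" using *[of v] V eq by (auto dest: symD[OF sym_rtrancl])
  then have "(u, v) \<in> ?r\<^sup>*" using *[of u] V by auto
  then show ?thesis by (rule rtrancl_imp_path_between)
qed

lemma cycle_in_mono: "cycle_in E q \<Longrightarrow> E \<subseteq> F \<Longrightarrow> cycle_in F q"
  unfolding cycle_in_def using successively_mono[of "\<lambda>x y. {x, y} \<in> E" q "\<lambda>x y. {x, y} \<in> F"]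
  by blast

text \<open>A vertex of maximal rank on a cycle would be joined to its parent by both incident edges.\<close>

lemma parent_edges_acyclic:
  assumes "ranked p N"
  shows "\<not> cycle_in (parent_edges p N) q"
proof
  assume q: "cycle_in (parent_edges p N) q"
  let ?adj = "\<lambda>x y. {x, y} \<in> parent_edges p N"
  obtain d :: "'a \<Rightarrow> nat" where d: "\<forall>v\<in>N. d (p v) < d v"
    using assms unfolding ranked_def by metis
  have up: "y = p x" if "?adj x y" "d y \<le> d x" for x y
  proof -
    obtain v where "v \<in> N" "{x, y} = {v, p v}" using \<open>?adj x y\<close> by (auto simp: parent_edges_def)
    then show ?thesis using d \<open>d y \<le> d x\<close> by (metis doubleton_eq_iff not_less)
  qed
  have "q \<noteq> []" using q by (auto simp: cycle_in_def)
  then have "Max (d ` set q) \<in> d ` set q" by (intro Max_in) auto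
  then obtain x where x: "x \<in> set q" "d x = Max (d ` set q)" by force
  have mx: "d y \<le> d x" if "y \<in> set q" for y using that unfolding x(2) by simp
  obtain as bs where ab: "q = as @ x # bs" using x(1) by (meson split_list)
  have s: "successively ?adj (as @ x # bs)" and l: "?adj (last (as @ x # bs)) (hd (as @ x # bs))"
    and dist: "distinct (as @ x # bs)" and len: "length as + length bs \<ge> 2"
    using q unfolding cycle_in_def ab by auto
  \<comment> \<open>Read cyclically from just after \<open>x\<close>, the cycle is
    \<open>bs @ as\<close>, so its last and first entries are the neighbours of \<open>x\<close>. If
    \<open>as\<close> or \<open>bs\<close> is empty, one of these adjacencies is the closing
    edge.\<close>
  define y where "y = last (bs @ as)"
  define z where "z = hd (bs @ as)"
  have "?adj y x"
  proof (cases "as = []")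
    case True
    then show ?thesis using l len by (simp add: y_def split: if_splits)
  next
    case False
    then show ?thesis using s by (simp add: y_def successively_append_iff)
  qed
  moreover have "?adj x z"
  proof (cases "bs = []")
    case True
    then show ?thesis using l len by (simp add: z_def hd_append split: if_splits)
  next
    case False
    then show ?thesis using s by (simp add: z_def successively_append_iff successively_Cons)
  qed
  moreover have "y \<in> set (bs @ as)" "z \<in> set (bs @ as)"
    using len unfolding y_def z_def by (intro last_in_set hd_in_set; force)+
  then have "y \<in> set q" "z \<in> set q" unfolding ab by auto
  ultimately have "y = z" using up mx by (metis insert_commute)
  moreover have "y \<noteq> z"
  proof (cases "bs @ as")
    case (Cons b cs)
    moreover have "distinct (bs @ as)" using dist by auto
    moreover have "length (bs @ as) \<ge> 2" using len by simp
    ultimately show ?thesis unfolding y_def z_def by auto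
  qed (use len in auto)
  ultimately show False by contradiction
qed

text \<open>The parent is the predecessor on a shortest path from the root. An edge that is not a
  parent edge would close a cycle with a path of parent edges.\<close>

lemma tree_imp_parent_edges:
  assumes T: "tree V E" and i: "i \<in> V"
  shows "\<exists>p. p ` (V - {i}) \<subseteq> V \<and> ranked p (V - {i}) \<and> parent_edges p (V - {i}) = E"
proof -
  define N where "N = V - {i}"
  \<comment> \<open>The number of vertices on a shortest path from \<open>i\<close>.\<close>
  define d where "d v = (LEAST m. \<exists>q. path_between E i q v \<and> length q = m)" for v
  have E: "e \<subseteq> V \<and> card e = 2" if "e \<in> E" for e
    using T that by (auto simp: tree_def simple_graph_def)
  have path: "\<exists>q. path_between E i q v" if "v \<in> V" for v
    using T that i by (auto simp: tree_def connected_graph_def)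
  have d_le: "d v \<le> length q" if "path_between E i q v" for v q
    unfolding d_def by (rule Least_le) (use that in blast)
  have "\<exists>u. u \<in> V \<and> {v, u} \<in> E \<and> d u < d v" if v: "v \<in> N" for v
  proof -
    have "\<exists>m q. path_between E i q v \<and> length q = m" using path v by (auto simp: N_def)
    from LeastI_ex[OF this] obtain q where q: "path_between E i q v" "length q = d v"
      unfolding d_def by blast
    \<comment> \<open>Dropping \<open>v\<close> leaves a path to its predecessor with one vertex
      fewer; it is nonempty because \<open>v\<close> differs from \<open>i\<close>.\<close>
    define q' where "q' = butlast q"
    have qq: "q = q' @ [v]" using q unfolding path_between_def q'_def by (metis append_butlast_last_id)
    have "q' \<noteq> []" using q qq v by (auto simp: path_between_def N_def)
    then have "path_between E i q' (last q')" and e: "{last q', v} \<in> E"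
      using q unfolding qq path_between_def by (auto simp: successively_append_iff)
    then have "d (last q') < d v" using d_le[of q'] q(2) qq by fastforce
    then show ?thesis using E[OF e] e by (auto simp: insert_commute)
  qed
  then obtain p where p: "\<And>v. v \<in> N \<Longrightarrow> p v \<in> V \<and> {v, p v} \<in> E \<and> d (p v) < d v"
    by metis
  have r: "ranked p N" and pV: "p ` N \<subseteq> V" and sub: "parent_edges p N \<subseteq> E"
    using p unfolding ranked_def parent_edges_def by blast+
  \<comment> \<open>With \<open>i\<close> as the only root, any two vertices are joined by parent
    edges.\<close>
  have root: "root_of p N v = i" if "v \<in> V" for v
    using root_of_in[OF r pV that] by (auto simp: N_def)
  have "E \<subseteq> parent_edges p N"
  proof
    fix e assume e: "e \<in> E"
    then obtain u v where uv: "e = {u, v}" "u \<noteq> v" using E by (meson card_2_iff)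
    then have V: "u \<in> V" "v \<in> V" using E[OF e] by auto
    then obtain q where q: "path_between (parent_edges p N) u q v"
      using path_between_same_root[OF r _ pV, of u v] root by (auto dest: path_between_mono[OF _ Collect_restrict])
    show "e \<in> parent_edges p N"
    proof (rule ccontr)
      assume "e \<notin> parent_edges p N"
      \<comment> \<open>A single vertex would force \<open>u = v\<close>, and two vertices would
        make \<open>e\<close> a parent edge; a longer path is closed by \<open>e\<close> to a
        cycle.\<close>
      have "\<not> length q \<le> 2"
      proof (cases q)
        case (Cons x xs)
        note q_Cons = this
        then show ?thesis
        proof (cases xs)
          case Nil
          then show ?thesis using q uv q_Cons by (auto simp: path_between_def)
        next
          case (Cons y ys)
          then show ?thesis using q uv q_Cons \<open>e \<notin> parent_edges p N\<close>
            by (cases ys) (auto simp: path_between_def)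
        qed
      qed (use q in \<open>simp add: path_between_def\<close>)
      moreover have "path_between E u q v" using q sub by (rule path_between_mono)
      ultimately have "cycle_in E q"
        using e uv by (simp add: cycle_in_def path_between_def insert_commute[of v u])
      then show False using T by (auto simp: tree_def)
    qed
  qed
  then show ?thesis using r pV sub unfolding N_def by blast
qed

section \<open>Special forests as coloured parent maps\<close>

text \<open>The colour of an edge is stored at its lower endpoint, which \<open>inv_into\<close>
  retrieves; the restriction makes the colouring extensional as in
  \<open>special_forests\<close>.\<close>

definition forest_of :: "'a set \<Rightarrow> ('a \<Rightarrow> 'a \<times> nat) \<Rightarrow> 'a set set \<times> ('a set \<Rightarrow> nat)" where
  "forest_of N g = (parent_edges (fst \<circ> g) N,
     \<lambda>e\<in>parent_edges (fst \<circ> g) N. snd (g (inv_into N (\<lambda>v. {v, fst (g v)}) e)))"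

lemma forest_of_edges: "fst (forest_of N g) = parent_edges (fst \<circ> g) N"
  by (simp add: forest_of_def)

lemma forest_of_color:
  assumes "ranked (fst \<circ> g) N" "v \<in> N"
  shows "snd (forest_of N g) {v, fst (g v)} = snd (g v)"
proof -
  have "inj_on (\<lambda>v. {v, fst (g v)}) N" using inj_on_parent_edge[OF assms(1)] by simp
  from inv_into_f_f[OF this assms(2)] show ?thesis
    using assms(2) by (auto simp: forest_of_def parent_edges_def)
qed

lemma inj_on_forest_of: "inj_on (forest_of (V - R)) (colored_forests V k R)"
proof (rule inj_onI)
  fix g g' assume g: "g \<in> colored_forests V k R" and g': "g' \<in> colored_forests V k R"
    and eq: "forest_of (V - R) g = forest_of (V - R) g'"
  have r: "ranked (fst \<circ> g) (V - R)" "ranked (fst \<circ> g') (V - R)"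
    using g g' by (simp_all add: colored_forests_def)
  have "g v = g' v" if v: "v \<in> V - R" for v
  proof -
    have "parent_edges (fst \<circ> g) (V - R) = parent_edges (fst \<circ> g') (V - R)"
      using eq forest_of_edges by metis
    from parent_edges_inj[OF r this v] have p: "fst (g v) = fst (g' v)" by simp
    have "snd (g v) = snd (g' v)"
      using forest_of_color[OF r(1) v] forest_of_color[OF r(2) v] eq p by simp
    with p show ?thesis by (simp add: prod_eq_iff)
  qed
  moreover have "g \<in> (V - R) \<rightarrow>\<^sub>E V \<times> {1..k}" "g' \<in> (V - R) \<rightarrow>\<^sub>E V \<times> {1..k}"
    using g g' by (simp_all add: colored_forests_def)
  ultimately show "g = g'" by (metis PiE_ext)
qed

text \<open>Two parent edges that meet either follow each other on the way to the root or share the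
  parent; the parent colour condition settles the former, injectivity the latter.\<close>

lemma forest_of_proper:
  assumes g: "g \<in> colored_forests V k R" and v: "v \<in> V - R" and w: "w \<in> V - R" and "v \<noteq> w"
    and meet: "{v, fst (g v)} \<inter> {w, fst (g w)} \<noteq> {}"
  shows "snd (g v) \<noteq> snd (g w)"
proof -
  have col: "snd (g x) \<noteq> snd (g (fst (g x)))" if "x \<in> V - R" "fst (g x) \<in> V - R" for x
  proof -
    have "snd (g x) \<noteq> parent_color k (V - R) g (fst (g x))" using g that by (simp add: colored_forests_def)
    then show ?thesis using that(2) by (simp add: parent_color_def)
  qed
  consider "v = fst (g w)" | "w = fst (g v)" | "fst (g v) = fst (g w)"
    using meet \<open>v \<noteq> w\<close> by auto
  then show ?thesis
  proof cases
    case 1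
    then show ?thesis using col[of w] v w by simp
  next
    case 2
    then show ?thesis using col[of v] v w by simp
  next
    case 3
    moreover have "g v \<noteq> g w"
      using g v w \<open>v \<noteq> w\<close> by (auto simp: colored_forests_def inj_on_def)
    ultimately show ?thesis by (simp add: prod_eq_iff)
  qed
qed

lemma forest_of_in_special_forests:
  assumes g: "g \<in> colored_forests {1..n} k {1..r}" and rn: "r \<le> n"
  shows "forest_of ({1..n} - {1..r}) g \<in> special_forests n k r"
proof -
  define N where "N = {1..n} - {1..r}"
  define p where "p = fst \<circ> g"
  define E where "E = parent_edges p N"
  define c where "c = snd (forest_of N g)"
  have gN: "g v \<in> {1..n} \<times> {1..k}" if "v \<in> N" for v
    using g that unfolding colored_forests_def N_def by blast
  have r: "ranked p N" using g by (simp add: colored_forests_def N_def p_def)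
  have pV: "p ` N \<subseteq> {1..n}" using gN by (force simp: p_def)
  have c: "c {v, p v} = snd (g v)" if "v \<in> N" for v
    using forest_of_color[of g N v] r that by (simp add: c_def p_def)
  have root: "root_of p N v \<in> {1..r}" if "v \<in> {1..n}" for v
    using root_of_in[OF r pV that] by (auto simp: N_def)
  have fix_root: "root_of p N i = i" if "i \<in> {1..r}" for i
    using that by (intro root_of_root[OF r]) (auto simp: N_def)
  \<comment> \<open>The trees are the fibres of the root map.\<close>
  define W where "W i = {v \<in> {1..n}. root_of p N v = i}" for i
  have E_iff: "e \<in> E \<longleftrightarrow> (\<exists>v\<in>N. e = {v, p v})" for e by (auto simp: E_def parent_edges_def)
  have E_W: "\<exists>i\<in>{1..r}. e \<subseteq> W i" if e: "e \<in> E" for e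
  proof -
    obtain v where v: "v \<in> N" "e = {v, p v}" using e unfolding E_iff by blast
    then have "v \<in> {1..n}" "p v \<in> {1..n}" using pV unfolding N_def by blast+
    then have "e \<subseteq> W (root_of p N v)" using v root_of_parent[OF r] by (simp add: W_def)
    then show ?thesis using root \<open>v \<in> {1..n}\<close> by blast
  qed
  have "special_edge_colored_tree k (W i) {e \<in> E. e \<subseteq> W i} c i" if i: "i \<in> {1..r}" for i
  proof -
    have "i \<in> W i" using i rn fix_root by (auto simp: W_def)
    have card: "card e = 2" if "e \<in> E" for e
      using that ranked_irrefl[OF r] unfolding E_iff by (auto simp: card_2_iff)
    have "connected_graph (W i) {e \<in> E. e \<subseteq> W i}"
      unfolding connected_graph_def
    proof (intro conjI ballI)
      show "W i \<noteq> {}" using \<open>i \<in> W i\<close> by blast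
    next
      fix u v assume uv: "u \<in> W i" "v \<in> W i"
      then show "\<exists>q. path_between {e \<in> E. e \<subseteq> W i} u q v"
        using path_between_same_root[OF r _ pV, of u v] by (simp add: W_def E_def)
    qed
    moreover have "\<not> cycle_in {e \<in> E. e \<subseteq> W i} q" for q
      using parent_edges_acyclic[OF r] cycle_in_mono[of "{e \<in> E. e \<subseteq> W i}" q E] by (auto simp: E_def)
    moreover have "simple_graph (W i) {e \<in> E. e \<subseteq> W i}"
      using card by (simp add: simple_graph_def W_def)
    ultimately have "tree (W i) {e \<in> E. e \<subseteq> W i}" by (simp add: tree_def)
    moreover have "c e \<in> {1..k}" if "e \<in> E" for e
      using that c gN unfolding E_iff by (auto simp: mem_Times_iff)
    moreover have "c e \<noteq> c f" if ef: "e \<in> E" "f \<in> E" "e \<noteq> f" "e \<inter> f \<noteq> {}" for e f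
    proof -
      obtain v w where vw: "v \<in> N" "w \<in> N" "e = {v, p v}" "f = {w, p w}"
        using ef(1,2) unfolding E_iff by blast
      then have "v \<noteq> w" "{v, fst (g v)} \<inter> {w, fst (g w)} \<noteq> {}"
        using ef(3,4) by (metis, simp add: p_def)
      then have "snd (g v) \<noteq> snd (g w)"
        using forest_of_proper[OF g] vw(1,2) unfolding N_def by blast
      then show ?thesis using c vw by simp
    qed
    moreover have "c e \<in> {1..k - 1}" if e: "e \<in> E" "i \<in> e" for e
    proof -
      obtain v where v: "v \<in> N" "e = {v, p v}" using e unfolding E_iff by blast
      \<comment> \<open>An edge at the root \<open>i\<close> leads to a child of \<open>i\<close>,
        whose colour differs from the default \<open>k\<close>.\<close>
      have "i \<notin> N" using i by (simp add: N_def)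
      then have "p v = i" using v e by auto
      moreover have "snd (g v) \<noteq> parent_color k N g (p v)"
        using g v by (simp add: colored_forests_def p_def N_def)
      ultimately have "snd (g v) \<noteq> k" using \<open>i \<notin> N\<close> by (simp add: parent_color_def)
      then show ?thesis using c[OF v(1)] gN[OF v(1)] v by (auto simp: mem_Times_iff)
    qed
    ultimately show ?thesis
      using \<open>i \<in> W i\<close> by (simp add: special_edge_colored_tree_def edge_colored_tree_def)
  qed
  moreover have "disjoint_family_on W {1..r}" by (auto simp: disjoint_family_on_def W_def)
  moreover have "(\<Union>i\<in>{1..r}. W i) = {1..n}" using root by (auto simp: W_def)
  moreover have "c \<in> extensional E" by (simp add: c_def forest_of_def E_def p_def)
  ultimately have "(E, c) \<in> special_forests n k r"
    using E_W unfolding special_forests_def by blast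
  moreover have "forest_of N g = (E, c)" by (simp add: E_def c_def p_def forest_of_def)
  ultimately show ?thesis unfolding N_def by simp
qed

lemma special_forest_imp_forest_of:
  assumes "(E, c) \<in> special_forests n k r"
  shows "\<exists>g\<in>colored_forests {1..n} k {1..r}. forest_of ({1..n} - {1..r}) g = (E, c)"
proof -
  define N where "N = {1..n} - {1..r}"
  obtain W where ext: "c \<in> extensional E" and disj: "disjoint_family_on W {1..r}"
    and U: "(\<Union>i\<in>{1..r}. W i) = {1..n}" and EW: "\<And>e. e \<in> E \<Longrightarrow> \<exists>i\<in>{1..r}. e \<subseteq> W i"
    and T: "\<And>i. i \<in> {1..r} \<Longrightarrow> special_edge_colored_tree k (W i) {e \<in> E. e \<subseteq> W i} c i"
    using assms unfolding special_forests_def by blast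
  have iW: "i \<in> W i" if "i \<in> {1..r}" for i
    using T[OF that] by (simp add: special_edge_colored_tree_def)
  \<comment> \<open>Each tree gets its own parent map; these are glued below by means of the index
    \<open>t v\<close> of the tree containing \<open>v\<close>.\<close>
  define Q where "Q i p \<longleftrightarrow> p ` (W i - {i}) \<subseteq> W i \<and> ranked p (W i - {i})
      \<and> parent_edges p (W i - {i}) = {e \<in> E. e \<subseteq> W i}" for i p
  have "\<forall>i\<in>{1..r}. \<exists>p. Q i p"
  proof
    fix i assume i: "i \<in> {1..r}"
    have "tree (W i) {e \<in> E. e \<subseteq> W i}"
      using T[OF i] by (simp add: special_edge_colored_tree_def edge_colored_tree_def)
    then show "\<exists>p. Q i p" unfolding Q_def using iW[OF i] by (rule tree_imp_parent_edges)
  qed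
  then obtain P where "\<forall>i\<in>{1..r}. Q i (P i)" using bchoice by blast
  then have P: "P i ` (W i - {i}) \<subseteq> W i" and PR: "ranked (P i) (W i - {i})"
    and PE: "parent_edges (P i) (W i - {i}) = {e \<in> E. e \<subseteq> W i}" if "i \<in> {1..r}" for i
    using that by (simp_all add: Q_def)
  have "\<forall>i\<in>{1..r}. \<exists>d::nat \<Rightarrow> nat. \<forall>v\<in>W i - {i}. d (P i v) < d v"
    using PR unfolding ranked_def by blast
  then obtain D :: "nat \<Rightarrow> nat \<Rightarrow> nat" where "\<forall>i\<in>{1..r}. \<forall>v\<in>W i - {i}. D i (P i v) < D i v"
    using bchoice[of "{1..r}" "\<lambda>i d. \<forall>v\<in>W i - {i}. d (P i v) < d v"] by blast
  then have D: "D i (P i v) < D i v" if "i \<in> {1..r}" "v \<in> W i - {i}" for i v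
    using that by blast
  have "\<forall>v\<in>{1..n}. \<exists>i. i \<in> {1..r} \<and> v \<in> W i" using U by blast
  then obtain t where t: "\<And>v. v \<in> {1..n} \<Longrightarrow> t v \<in> {1..r} \<and> v \<in> W (t v)" by metis
  have WV: "v \<in> {1..n}" if "i \<in> {1..r}" "v \<in> W i" for i v using that U by blast
  have t_eq: "t v = i" if "i \<in> {1..r}" "v \<in> W i" for i v
    using that t[OF WV[OF that]] disj unfolding disjoint_family_on_def by blast
  define p where "p v = P (t v) v" for v
  have tN: "t v \<in> {1..r}" "v \<in> W (t v) - {t v}" if "v \<in> N" for v
    using t[of v] that by (auto simp: N_def)
  \<comment> \<open>By disjointness, a vertex of \<open>W i\<close> other than \<open>i\<close>
    cannot be the root of another tree.\<close>
  have NW: "v \<in> N" if "i \<in> {1..r}" "v \<in> W i - {i}" for i v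
  proof -
    have "v \<notin> {1..r}" using t_eq[of i v] t_eq[of v v] iW[of v] that by auto
    then show ?thesis using WV that by (auto simp: N_def)
  qed
  have pW: "p v \<in> W (t v)" if "v \<in> N" for v using P tN[OF that] unfolding p_def by blast
  have tp: "t (p v) = t v" if "v \<in> N" for v using t_eq tN pW that by blast
  \<comment> \<open>Parent steps stay in one tree, so the ranks of different trees are never
    compared.\<close>
  have "\<forall>v\<in>N. D (t (p v)) (p v) < D (t v) v"
    using D tN by (simp add: tp) (simp add: p_def)
  then have r: "ranked p N" unfolding ranked_def by (intro exI[of _ "\<lambda>v. D (t v) v"])
  have edge: "{v, p v} \<in> E" "{v, p v} \<subseteq> W (t v)" if "v \<in> N" for v
  proof -
    have "{v, p v} \<in> parent_edges (P (t v)) (W (t v) - {t v})"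
      using tN[OF that] by (auto simp: parent_edges_def p_def)
    then show "{v, p v} \<in> E" "{v, p v} \<subseteq> W (t v)" using PE[OF tN(1)[OF that]] by auto
  qed
  have E_eq: "parent_edges p N = E"
  proof
    show "parent_edges p N \<subseteq> E" using edge by (auto simp: parent_edges_def)
    show "E \<subseteq> parent_edges p N"
    proof
      fix e assume "e \<in> E"
      then obtain i where i: "i \<in> {1..r}" "e \<in> {e \<in> E. e \<subseteq> W i}" using EW by blast
      then obtain v where v: "v \<in> W i - {i}" "e = {v, P i v}"
        unfolding PE[OF i(1), symmetric] parent_edges_def by blast
      moreover have "P i v = p v" using t_eq[OF i(1)] v by (simp add: p_def)
      ultimately show "e \<in> parent_edges p N" using NW[OF i(1)] by (auto simp: parent_edges_def)
    qed
  qed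
  have ck: "c {v, p v} \<in> {1..k}" if "v \<in> N" for v
    using T[OF tN(1)[OF that]] edge[OF that] by (simp add: special_edge_colored_tree_def edge_colored_tree_def)
  \<comment> \<open>Colours are compared within one tree only; siblings, or a vertex and its parent,
    always lie in the same tree.\<close>
  have proper: "c {v, p v} \<noteq> c {w, p w}"
    if vw: "v \<in> N" "w \<in> N" "v \<noteq> w" "t v = t w" "{v, p v} \<inter> {w, p w} \<noteq> {}" for v w
  proof -
    have "{v, p v} \<noteq> {w, p w}" using inj_on_parent_edge[OF r] vw by (auto simp: inj_on_def)
    then show ?thesis
      using T[OF tN(1)[OF vw(1)]] edge[OF vw(1)] edge[OF vw(2)] vw(4,5)
      unfolding special_edge_colored_tree_def edge_colored_tree_def by auto
  qed
  define g where "g = (\<lambda>v\<in>N. (p v, c {v, p v}))"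
  have gN: "g v = (p v, c {v, p v})" if "v \<in> N" for v using that by (simp add: g_def)
  have pV: "p v \<in> {1..n}" if "v \<in> N" for v using WV tN(1) pW that by blast
  then have "g \<in> N \<rightarrow>\<^sub>E {1..n} \<times> {1..k}" using ck by (auto simp: g_def)
  moreover have "inj_on g N"
  proof (rule inj_onI, rule ccontr)
    fix v w assume vw: "v \<in> N" "w \<in> N" "g v = g w" "v \<noteq> w"
    then have "p v = p w" "c {v, p v} = c {w, p w}"
      unfolding gN[OF vw(1)] gN[OF vw(2)] prod.inject by blast+
    then show False using proper[OF vw(1,2,4)] tp[OF vw(1)] tp[OF vw(2)] by auto
  qed
  moreover have rg: "ranked (fst \<circ> g) N"
  proof -
    have "(fst \<circ> g) v = p v" if "v \<in> N" for v using gN[OF that] by simp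
    then show ?thesis using r ranked_cong[of N "fst \<circ> g" p] by blast
  qed
  moreover have "snd (g v) \<noteq> parent_color k N g (fst (g v))" if v: "v \<in> N" for v
  proof (cases "p v \<in> N")
    case True
    have "c {v, p v} \<noteq> c {p v, p (p v)}"
      using proper[OF v True] ranked_irrefl[OF r v] tp[OF v] by auto
    then show ?thesis using True v by (simp add: gN parent_color_def)
  next
    case False
    then have "p v \<in> {1..r}" using pV[OF v] by (auto simp: N_def)
    \<comment> \<open>A parent that is a root must be the root of the tree of \<open>v\<close>
      itself, so the special condition there excludes the default \<open>k\<close>.\<close>
    then have "p v = t v" using tp[OF v] t_eq iW by metis
    then have "c {v, p v} \<in> {1..k - 1}"
      using T[OF tN(1)[OF v]] edge[OF v] by (simp add: special_edge_colored_tree_def)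
    then show ?thesis using False v by (auto simp: gN parent_color_def)
  qed
  ultimately have "g \<in> colored_forests {1..n} k {1..r}"
    by (simp add: colored_forests_def N_def)
  moreover have "forest_of N g = (E, c)"
  proof -
    have E': "parent_edges (fst \<circ> g) N = E"
      unfolding E_eq[symmetric] parent_edges_def by (intro image_cong) (simp_all add: gN)
    have "snd (forest_of N g) e = c e" for e
    proof (cases "e \<in> E")
      case True
      then obtain v where v: "v \<in> N" "e = {v, p v}" unfolding E_eq[symmetric] by (auto simp: parent_edges_def)
      then show ?thesis using forest_of_color[OF rg v(1)] by (simp add: gN)
    next
      case False
      then show ?thesis using extensional_arb[OF ext False] by (simp add: forest_of_def E')
    qed
    then show ?thesis using E' by (intro prod_eqI) (auto simp: forest_of_edges)
  qed
  ultimately show ?thesis unfolding N_def by blast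
qed

text \<open>The root map is constant along a path, and \<open>x\<close> is its own root, so a path
  through \<open>x\<close> ending in \<open>y\<close> forces \<open>x\<close> to be the root of
  \<open>y\<close>. Conversely, the tree of \<open>x\<close> contains a path from \<open>x\<close>
  to \<open>y\<close>.\<close>

lemma descendant_iff_root_of:
  assumes r: "ranked p (V - R)" and pV: "p ` (V - R) \<subseteq> V" and x: "x \<in> R" "R \<subseteq> V" and y: "y \<in> V"
  shows "descendant (parent_edges p (V - R)) R y x \<longleftrightarrow> root_of p (V - R) y = x"
proof
  have rx: "root_of p (V - R) x = x" using x by (intro root_of_root[OF r]) simp
  {
    assume "descendant (parent_edges p (V - R)) R y x"
    then obtain q where q: "q \<noteq> []" "last q = y" "x \<in> set q"
      "successively (\<lambda>u v. {u, v} \<in> parent_edges p (V - R)) q"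
      by (auto simp: descendant_def path_between_def)
    then have "root_of p (V - R) y = root_of p (V - R) x"
      using root_of_walk[OF r q(4)] last_in_set[OF q(1)] by metis
    then show "root_of p (V - R) y = x" using rx by simp
  }
  assume "root_of p (V - R) y = x"
  then have "root_of p (V - R) x = root_of p (V - R) y" using rx by simp
  moreover have "x \<in> V" using x by blast
  ultimately obtain q where "path_between {e \<in> parent_edges p (V - R).
      e \<subseteq> {z \<in> V. root_of p (V - R) z = root_of p (V - R) x}} x q y"
    using path_between_same_root[OF r _ pV _ y, of x] by (elim meta_impE exE)
  then have q: "path_between (parent_edges p (V - R)) x q y"
    by (rule path_between_mono) (rule Collect_restrict)
  then have "x \<in> set q" by (auto simp: path_between_def)
  with q show "descendant (parent_edges p (V - R)) R y x" using x unfolding descendant_def by blast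
qed

section \<open>Transfer of the recursion to special forests\<close>

lemma card_special_forests_desc:
  assumes "1 \<le> k" "a \<in> {1..r}" "r \<le> n" "y \<in> {1..n}"
  shows "card (special_forests_desc n k r y a)
    = card {f \<in> slot_forests {1..n} {1..k - 1} {1..r}. slot_root {1..n} {1..r} f y = a}"
proof -
  let ?h = "forest_of ({1..n} - {1..r})"
  let ?C = "colored_forests {1..n} k {1..r}"
  have im: "?h ` ?C = special_forests n k r"
  proof (intro equalityI image_subsetI subsetI)
    show "?h g \<in> special_forests n k r" if "g \<in> ?C" for g
      using forest_of_in_special_forests[OF that \<open>r \<le> n\<close>] .
    show "z \<in> ?h ` ?C" if "z \<in> special_forests n k r" for z
      using special_forest_imp_forest_of[of "fst z" "snd z" n k r] that unfolding prod.collapse by blast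
  qed
  have desc: "descendant (fst (?h g)) {1..r} y a \<longleftrightarrow> slot_root {1..n} {1..r} g y = a" if "g \<in> ?C" for g
    unfolding forest_of_edges slot_root_def
  proof (rule descendant_iff_root_of)
    show "ranked (fst \<circ> g) ({1..n} - {1..r})" using that by (simp add: colored_forests_def)
    have "g ` ({1..n} - {1..r}) \<subseteq> {1..n} \<times> {1..k}" using that unfolding colored_forests_def by blast
    then show "(fst \<circ> g) ` ({1..n} - {1..r}) \<subseteq> {1..n}"
      unfolding image_comp[symmetric] by (auto dest: subsetD)
  qed (use assms in auto)
  have "special_forests_desc n k r y a = {z \<in> ?h ` ?C. descendant (fst z) {1..r} y a}"
    unfolding im special_forests_desc_def by auto
  also have "\<dots> = ?h ` {g \<in> ?C. descendant (fst (?h g)) {1..r} y a}" by blast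
  also have "{g \<in> ?C. descendant (fst (?h g)) {1..r} y a} = {g \<in> ?C. slot_root {1..n} {1..r} g y = a}"
    using desc by (intro Collect_cong conj_cong refl)
  finally have "card (special_forests_desc n k r y a) = card {g \<in> ?C. slot_root {1..n} {1..r} g y = a}"
    by (simp only: card_image[OF inj_on_subset[OF inj_on_forest_of Collect_restrict]])
  then show ?thesis by (simp only: card_colored_forests_root[OF \<open>1 \<le> k\<close>])
qed

theorem theorem5p1:
  fixes k n r :: nat
  assumes "k \<ge> 1" and "2 \<le> r" and "r \<le> n - 1"
  shows "int (card (special_forests_desc n k (r - 1) n 1))
    = (int k * int n - 2 * int n + int r) * int (card (special_forests_desc n k r n 1))"
proof -
  have R: "{1..r} - {r} = {1..r - 1}" using assms by auto
  \<comment> \<open>The root \<open>r\<close> is attached, with \<open>1\<close> as the other root: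
    2 \<le> \<open>r\<close> makes them distinct, and \<open>r\<close> \<le> \<open>n - 1\<close>
    makes \<open>n\<close> a non-root.\<close>
  have "int (card {f \<in> slot_forests {1..n} {1..k - 1} ({1..r} - {r}). slot_root {1..n} ({1..r} - {r}) f n = 1})
    = (int (card {1..n}) * int (card {1..k - 1}) - int (card {1..n}) + int (card {1..r}))
      * int (card {f \<in> slot_forests {1..n} {1..k - 1} {1..r}. slot_root {1..n} {1..r} f n = 1})"
    using assms by (intro card_slot_forests_merge) auto
  moreover have "int (card {1..n}) * int (card {1..k - 1}) - int (card {1..n}) + int (card {1..r})
    = int k * int n - 2 * int n + int r"
    using assms by (simp add: of_nat_diff algebra_simps)
  moreover have "card (special_forests_desc n k r n 1)
    = card {f \<in> slot_forests {1..n} {1..k - 1} {1..r}. slot_root {1..n} {1..r} f n = 1}"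
    "card (special_forests_desc n k (r - 1) n 1)
    = card {f \<in> slot_forests {1..n} {1..k - 1} {1..r - 1}. slot_root {1..n} {1..r - 1} f n = 1}"
    using assms by (intro card_special_forests_desc; simp)+
  ultimately show ?thesis unfolding R by simp
qed

end
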